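(* Let $p,q$ be nonnegative integers such that $p=1$ or $q=1$. Then every (finite or infinite) $(p,q)$-diagonal unitary matrix is a direct sum of diagonal blocks, each of order not greater than $p+q$.
   Context: Matrices are complex and either finite square or infinite with rows and columns indexed by $\mathbb{N}=\{1,2,\dots\}$. A matrix $(c_{i,j})$ is $(p,q)$-diagonal if $c_{i,j}=0$ whenever $i-j>p$ or $j-i>q$. An infinite bounded matrix is identified with the operator it defines on $\ell^2(\mathbb{N})$ with respect to the canonical basis; unitarity of a matrix is understood in this sense. "Direct sum of diagonal blocks" means that the matrix, with its given ordering of rows and columns, is block diagonal with square blocks along the main diagonal. *)

theory Defs
  imports Complex_Main "Jordan_Normal_Form.Schur_Decomposition"
begin

(* Rows and columns are numbered from 0, both for finite matrices (type complex mat) and for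
   infinite ones (functions nat => nat => complex).  This is a simultaneous shift of the row and
   column indices, so i - j is the same as for numbering from 1. *)

(* I is the common index set of rows and columns; the inequalities i > j + p and j > i + q
   are i - j > p and j - i > q without truncated subtraction. *)
definition pq_diagonal :: "nat set \<Rightarrow> nat \<Rightarrow> nat \<Rightarrow> (nat \<Rightarrow> nat \<Rightarrow> complex) \<Rightarrow> bool" where
  "pq_diagonal I p q c \<longleftrightarrow> (\<forall>i\<in>I. \<forall>j\<in>I. i > j + p \<or> j > i + q \<longrightarrow> c i j = 0)"

definition unitary_mat :: "complex mat \<Rightarrow> bool" where
  "unitary_mat A \<longleftrightarrow> square_mat A \<and> inverts_mat A (mat_adjoint A) \<and> inverts_mat (mat_adjoint A) A"

definition l2 :: "(nat \<Rightarrow> complex) set" where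
  "l2 = {x. summable (\<lambda>i. (cmod (x i))\<^sup>2)}"

definition l2_norm :: "(nat \<Rightarrow> complex) \<Rightarrow> real" where
  "l2_norm x = sqrt (\<Sum>i. (cmod (x i))\<^sup>2)"

definition l2_inner :: "(nat \<Rightarrow> complex) \<Rightarrow> (nat \<Rightarrow> complex) \<Rightarrow> complex" where
  "l2_inner x y = (\<Sum>i. x i * cnj (y i))"

definition inf_mat_op :: "(nat \<Rightarrow> nat \<Rightarrow> complex) \<Rightarrow> (nat \<Rightarrow> complex) \<Rightarrow> (nat \<Rightarrow> complex)" where
  "inf_mat_op A x = (\<lambda>i. \<Sum>j. A i j * x j)"

definition bounded_inf_mat :: "(nat \<Rightarrow> nat \<Rightarrow> complex) \<Rightarrow> bool" where
  "bounded_inf_mat A \<longleftrightarrow>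
     (\<forall>x\<in>l2. (\<forall>i. summable (\<lambda>j. A i j * x j)) \<and> inf_mat_op A x \<in> l2) \<and>
     (\<exists>K. \<forall>x\<in>l2. l2_norm (inf_mat_op A x) \<le> K * l2_norm x)"

(* S is the Hilbert space adjoint of the operator T of A; the last two equations are
   S T = I and T S = I on l2. *)
definition unitary_inf_mat :: "(nat \<Rightarrow> nat \<Rightarrow> complex) \<Rightarrow> bool" where
  "unitary_inf_mat A \<longleftrightarrow> bounded_inf_mat A \<and>
     (\<exists>S. (\<forall>y\<in>l2. S y \<in> l2) \<and>
          (\<forall>x\<in>l2. \<forall>y\<in>l2. l2_inner (inf_mat_op A x) y = l2_inner x (S y)) \<and>
          (\<forall>x\<in>l2. S (inf_mat_op A x) = x \<and> inf_mat_op A (S x) = x))"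

definition block_start :: "(nat \<Rightarrow> complex mat) \<Rightarrow> nat \<Rightarrow> nat" where
  "block_start B k = (\<Sum>l<k. dim_row (B l))"

definition block_range :: "(nat \<Rightarrow> complex mat) \<Rightarrow> nat \<Rightarrow> nat set" where
  "block_range B k = {block_start B k..<block_start B (Suc k)}"

(* Infinite analogue of diag_block_mat: A is the direct sum of B 0, B 1, ...  Since all blocks
   have positive order, their index ranges partition the natural numbers. *)
definition inf_direct_sum :: "(nat \<Rightarrow> nat \<Rightarrow> complex) \<Rightarrow> (nat \<Rightarrow> complex mat) \<Rightarrow> bool" where
  "inf_direct_sum A B \<longleftrightarrow>
     (\<forall>k. square_mat (B k) \<and> dim_row (B k) > 0) \<and>
     (\<forall>k. \<forall>i\<in>block_range B k. \<forall>j\<in>block_range B k.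
        A i j = B k $$ (i - block_start B k, j - block_start B k)) \<and>
     (\<forall>i j. (\<nexists>k. i \<in> block_range B k \<and> j \<in> block_range B k) \<longrightarrow> A i j = 0)"

end

(* Say p = 1; the case q = 1 follows by transposition.  Let a block start at row s.  If the entries
   (s+k+1, s+k) with k <= q were all nonzero, then orthogonality of row s to the rows s+q+1, ..., s+1,
   in this order, would annihilate the entries s+q, ..., s of row s, which is then zero.  So some
   (t, t-1) with s < t <= s+q+1 vanishes, and the first t columns are supported in the first t rows.
   Counting the sum of squared moduli of the leading t x t block by columns gives t; each of its
   rows contributes at most 1, hence exactly 1, and the upper right block vanishes as well.
   A finite matrix is extended by the infinite identity matrix, which makes its order
   a further splitting point. *)
theory Submission
  imports Defs
begin

section \<open>Orthonormality and splitting points\<close>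

text \<open>Using \<open>sums\<close> rather than an equation between values makes convergence part
  of the notion. Imposed on a matrix and on its transpose, it is the common form of unitarity for
  the finite and the infinite case.\<close>

definition orthonormal_rows :: "(nat \<Rightarrow> nat \<Rightarrow> complex) \<Rightarrow> bool" where
  "orthonormal_rows c \<longleftrightarrow>
     (\<forall>i j. (\<lambda>k. c i k * cnj (c j k)) sums (if i = j then 1 else 0))"

text \<open>A cut just before index \<open>n\<close>: the first \<open>n\<close> basis vectors span
  a reducing subspace. Both off-diagonal corners are required to vanish, which makes the notion
  invariant under transposition.\<close>

definition splits_at :: "(nat \<Rightarrow> nat \<Rightarrow> complex) \<Rightarrow> nat \<Rightarrow> bool" where
  "splits_at c n \<longleftrightarrow> (\<forall>i<n. \<forall>j\<ge>n. c i j = 0 \<and> c j i = 0)"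

lemma orthonormal_rowsD:
  "orthonormal_rows c \<Longrightarrow> (\<lambda>k. c i k * cnj (c j k)) sums (if i = j then 1 else 0)"
  by (simp add: orthonormal_rows_def)

lemma splits_at_0 [simp]: "splits_at c 0"
  by (simp add: splits_at_def)

lemma splits_at_transpose: "splits_at (\<lambda>i j. c j i) n \<longleftrightarrow> splits_at c n"
  by (auto simp: splits_at_def)

lemma pq_diagonal_transpose:
  "pq_diagonal UNIV p q c \<Longrightarrow> pq_diagonal UNIV q p (\<lambda>i j. c j i)"
  by (auto simp: pq_diagonal_def)

lemma pq_diagonal_UNIV_D:
  "pq_diagonal UNIV p q c \<Longrightarrow> i > j + p \<or> j > i + q \<Longrightarrow> c i j = 0"
  by (auto simp: pq_diagonal_def)

lemma orthonormal_rows_norm: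
  assumes "orthonormal_rows c"
  shows "(\<lambda>k. (cmod (c i k))\<^sup>2) sums 1"
proof -
  have "(\<lambda>k. c i k * cnj (c i k)) sums 1"
    using orthonormal_rowsD[OF assms, of i i] by simp
  then have "(\<lambda>k. complex_of_real ((cmod (c i k))\<^sup>2)) sums complex_of_real 1"
    by (simp only: complex_norm_square of_real_1)
  then show ?thesis by (simp only: sums_of_real_iff)
qed

text \<open>A finite-dimensional invariant subspace of a unitary operator is reducing, by a count of
  squared moduli.\<close>

lemma block_triangular_splits_at:
  assumes rows: "orthonormal_rows c" and cols: "orthonormal_rows (\<lambda>i j. c j i)"
    and zero: "\<And>i j. i < t \<Longrightarrow> j \<ge> t \<Longrightarrow> c j i = 0"
  shows "splits_at c t"
proof -
  define f where "f i j = (cmod (c i j))\<^sup>2" for i j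
  have row_norm: "f i sums 1" for i
    using orthonormal_rows_norm[OF rows, of i] unfolding f_def .
  have row_le: "sum (f i) K \<le> 1" if "finite K" for i K
    using sum_le_suminf[of "f i" K] row_norm[of i] that
    by (auto simp: f_def sums_iff)
  have col: "(\<Sum>i<t. f i j) = 1" if "j < t" for j
  proof -
    have "(\<lambda>i. f i j) sums (\<Sum>i<t. f i j)"
      using zero that by (intro sums_finite) (auto simp: f_def)
    moreover have "(\<lambda>i. f i j) sums 1"
      using orthonormal_rows_norm[OF cols, of j] unfolding f_def .
    ultimately show ?thesis by (rule sums_unique2)
  qed
  \<comment> \<open>The left side is the total deficiency of the truncated rows. Each summand is
    nonnegative, so a vanishing total makes each of them vanish.\<close>
  have "(\<Sum>i<t. 1 - (\<Sum>j<t. f i j)) = real t - (\<Sum>j<t. \<Sum>i<t. f i j)"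
    by (simp add: sum_subtractf sum.swap[of f])
  also have "\<dots> = 0" using col by simp
  finally have "\<forall>i\<in>{..<t}. 1 - (\<Sum>j<t. f i j) = 0"
    using row_le by (subst (asm) sum_nonneg_eq_0_iff) auto
  then have full: "(\<Sum>j<t. f i j) = 1" if "i < t" for i using that by auto
  have "c i j = 0" if "i < t" "j \<ge> t" for i j
  proof -
    have "f i j + (\<Sum>j<t. f i j) \<le> 1"
      using row_le[of "insert j {..<t}" i] that(2) by simp
    with full[OF that(1)] show ?thesis by (simp add: f_def)
  qed
  with zero show ?thesis by (auto simp: splits_at_def)
qed

section \<open>Existence of the next splitting point\<close>

lemma hessenberg_next_split:
  assumes rows: "orthonormal_rows c" and cols: "orthonormal_rows (\<lambda>i j. c j i)"
    and diag: "pq_diagonal UNIV 1 q c" and s: "splits_at c s"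
  shows "\<exists>t. s < t \<and> t \<le> s + q + 1 \<and> splits_at c t"
proof -
  have "\<exists>k\<le>q. c (s + k + 1) (s + k) = 0"
  proof (rule ccontr)
    assume "\<not> ?thesis"
    then have nz: "c (s + k + 1) (s + k) \<noteq> 0" if "k \<le> q" for k using that by auto
    have row_s: "c s (s + k) = 0" for k
    \<comment> \<open>The induction runs from the right end of the band to the left. Offsets beyond
      \<open>q\<close> are settled by the band condition in \<open>later\<close>, so the truncation
      of the measure there does no harm.\<close>
    proof (induction "s + q - k" arbitrary: k rule: less_induct)
      have later: "c s (s + m) = 0" if "m > q" for m
        using that by (intro pq_diagonal_UNIV_D[OF diag]) auto
      fix k
      assume IH: "\<And>m. s + q - m < s + q - k \<Longrightarrow> c s (s + m) = 0"
      show "c s (s + k) = 0"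
      proof (cases "k \<le> q")
        case True
        have gt: "c s l = 0" if "l > s + k" for l
        proof (cases "l - s > q")
          case True
          with later[of "l - s"] that show ?thesis by simp
        next
          case False
          with that have "s + q - (l - s) < s + q - k" by linarith
          from IH[OF this] that show ?thesis by simp
        qed
        \<comment> \<open>Row \<open>s\<close> vanishes to the right of column \<open>s + k\<close>,
          and row \<open>s + k + 1\<close> vanishes to the left of it since the lower bandwidth is
          1. The inner product thus has a single term.\<close>
        have "c s l * cnj (c (s + k + 1) l) = 0" if "l \<noteq> s + k" for l
        proof (cases "l > s + k")
          case True
          with gt show ?thesis by simp
        next
          case False
          with that have "c (s + k + 1) l = 0"
            by (intro pq_diagonal_UNIV_D[OF diag]) auto
          then show ?thesis by simp
        qed
        then have "(\<lambda>l. c s l * cnj (c (s + k + 1) l)) sums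
            (\<Sum>l\<in>{s + k}. c s l * cnj (c (s + k + 1) l))"
          by (intro sums_finite) auto
        moreover have "(\<lambda>l. c s l * cnj (c (s + k + 1) l)) sums 0"
          using orthonormal_rowsD[OF rows, of s "s + k + 1"] by simp
        ultimately have "(\<Sum>l\<in>{s + k}. c s l * cnj (c (s + k + 1) l)) = 0"
          by (rule sums_unique2)
        with nz[OF True] show ?thesis by simp
      qed (use later in auto)
    qed
    \<comment> \<open>Left of column \<open>s\<close> the row vanishes because \<open>s\<close> is
      itself a splitting point.\<close>
    have "c s l = 0" for l
    proof (cases "l < s")
      case True
      with s show ?thesis by (auto simp: splits_at_def)
    next
      case False
      with row_s[of "l - s"] show ?thesis by simp
    qed
    with orthonormal_rows_norm[OF rows, of s] show False
      by (simp add: sums_iff)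
  qed
  then obtain k where k: "k \<le> q" "c (s + k + 1) (s + k) = 0" by blast
  \<comment> \<open>With lower bandwidth 1, the corner below the cut at \<open>s + k + 1\<close> can
    be nonzero only in the entry chosen as \<open>k\<close>.\<close>
  have "c j i = 0" if "i < s + k + 1" "j \<ge> s + k + 1" for i j
  proof (cases "i = s + k \<and> j = s + k + 1")
    case False
    with that show ?thesis by (intro pq_diagonal_UNIV_D[OF diag]) auto
  qed (use k in auto)
  then have "splits_at c (s + k + 1)"
    by (rule block_triangular_splits_at[OF rows cols])
  with k show ?thesis by (intro exI[of _ "s + k + 1"]) auto
qed

lemma pq_diagonal_next_split:
  assumes pq: "p = 1 \<or> q = 1"
    and rows: "orthonormal_rows c" and cols: "orthonormal_rows (\<lambda>i j. c j i)"
    and diag: "pq_diagonal UNIV p q c" and s: "splits_at c s"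
  shows "\<exists>t. s < t \<and> t \<le> s + (p + q) \<and> splits_at c t"
  using pq
proof
  assume "p = 1"
  with hessenberg_next_split[OF rows cols _ s] diag show ?thesis by auto
next
  assume "q = 1"
  with pq_diagonal_transpose[OF diag] have "pq_diagonal UNIV 1 p (\<lambda>i j. c j i)" by simp
  from hessenberg_next_split[OF cols rows this] s \<open>q = 1\<close> show ?thesis
    unfolding splits_at_transpose[of c] by auto
qed

section \<open>From splitting points to block decompositions\<close>

text \<open>The statement is about the trailing submatrix from \<open>s\<close> on, so that an
  induction on its order \<open>n - s\<close> can peel off the leading block.\<close>

lemma diag_blocks_from_splits:
  assumes "s \<le> n" and n: "splits_at c n" and "splits_at c s"
    and next_split: "\<And>s. splits_at c s \<Longrightarrow> \<exists>t. s < t \<and> t \<le> s + d \<and> splits_at c t"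
  shows "\<exists>Bs. mat (n - s) (n - s) (\<lambda>(i, j). c (s + i) (s + j)) = diag_block_mat Bs \<and>
     (\<forall>B\<in>set Bs. square_mat B \<and> 0 < dim_row B \<and> dim_row B \<le> d)"
  using assms(1,3)
proof (induction "n - s" arbitrary: s rule: less_induct)
  case less
  show ?case
  proof (cases "s = n")
    case True
    then show ?thesis by (intro exI[of _ "[]"]) auto
  next
    case False
    \<comment> \<open>The next splitting point may lie beyond \<open>n\<close>; then
      \<open>n\<close> itself is taken, which is closer to \<open>s\<close> and also splits.\<close>
    obtain t where t: "s < t" "t \<le> s + d" "splits_at c t" "t \<le> n"
      using next_split[OF less.prems(2)] n less.prems(1) False
      by (metis le_neq_implies_less le_trans nat_le_linear)
    let ?M = "\<lambda>s m. mat m m (\<lambda>(i, j). c (s + i) (s + j))"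
    obtain Bs where Bs: "?M t (n - t) = diag_block_mat Bs"
        "\<forall>B\<in>set Bs. square_mat B \<and> 0 < dim_row B \<and> dim_row B \<le> d"
      using less.hyps[of t] t by force
    have dims: "dim_row (diag_block_mat Bs) = n - t" "dim_col (diag_block_mat Bs) = n - t"
      using Bs(1) by (metis dim_row_mat(1), metis dim_col_mat(1))
    have "?M s (n - s) = diag_block_mat (?M s (t - s) # Bs)"
    proof (rule eq_matI)
      fix i j
      assume ij: "i < dim_row (diag_block_mat (?M s (t - s) # Bs))"
        "j < dim_col (diag_block_mat (?M s (t - s) # Bs))"
      then have lt: "i < n - s" "j < n - s" using dims t by (auto simp: Let_def)
      have off: "c x y = 0" if "x < t \<and> t \<le> y \<or> y < t \<and> t \<le> x" for x y
        using that t(3) by (auto simp: splits_at_def)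
      \<comment> \<open>The offset \<open>i - (t - s)\<close> in the tail, which starts at
        \<open>t\<close>, is again row \<open>s + i\<close> of \<open>c\<close>; likewise for
        columns.\<close>
      have "diag_block_mat (?M s (t - s) # Bs) $$ (i, j) =
          (if i < t - s then if j < t - s then c (s + i) (s + j) else 0
           else if j < t - s then 0 else ?M t (n - t) $$ (i - (t - s), j - (t - s)))"
        using lt t Bs(1) dims by (auto simp: Let_def simp flip: Bs(1))
      also have "\<dots> = ?M s (n - s) $$ (i, j)"
        using lt t(1) off[of "s + i" "s + j"] by (auto simp: less_diff_conv not_less add.commute)
      finally show "?M s (n - s) $$ (i, j) = diag_block_mat (?M s (t - s) # Bs) $$ (i, j)" ..
    qed (use dims t in \<open>auto simp: Let_def\<close>)
    with Bs t show ?thesis by (intro exI[of _ "?M s (t - s) # Bs"]) auto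
  qed
qed

lemma inf_direct_sum_from_splits:
  assumes next_split: "\<And>s. splits_at c s \<Longrightarrow> \<exists>t. s < t \<and> t \<le> s + d \<and> splits_at c t"
  shows "\<exists>B. inf_direct_sum c B \<and> (\<forall>k. dim_row (B k) \<le> d)"
proof -
  obtain b where b: "\<And>k. splits_at c (b k)" "b 0 = 0"
    "\<And>k. b k < b (Suc k) \<and> b (Suc k) \<le> b k + d"
  proof (atomize_elim, goal_cases)
    case 1
    \<comment> \<open>Dependent choice of successive splitting points, starting from the trivial one
      at 0.\<close>
    have "\<exists>f. \<forall>k. (splits_at c (f k) \<and> (k = 0 \<longrightarrow> f k = 0)) \<and>
        (f k < f (Suc k) \<and> f (Suc k) \<le> f k + d)"
      by (rule dependent_nat_choice) (use next_split in auto)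
    then show ?case by metis
  qed
  have mono: "strict_mono b" using b(3) by (simp add: strict_mono_Suc_iff)
  define B where "B k = mat (b (Suc k) - b k) (b (Suc k) - b k) (\<lambda>(i, j). c (b k + i) (b k + j))"
    for k
  have start: "block_start B k = b k" for k
  proof (induction k)
    case (Suc k)
    with b(3)[of k] show ?case by (simp add: block_start_def B_def)
  qed (simp add: block_start_def b)
  have range: "block_range B k = {b k..<b (Suc k)}" for k
    by (simp add: block_range_def start)
  have cover: "\<exists>k. i \<in> block_range B k" for i
  proof -
    have "i < b (Suc i)" using strict_mono_imp_increasing[OF mono, of "Suc i"] by simp
    then have ex: "\<exists>k. i < b k" by blast
    \<comment> \<open>The first cut beyond \<open>i\<close> closes the block containing
      \<open>i\<close>. It is not cut number 0, as that one lies at 0.\<close>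
    define m where "m = (LEAST k. i < b k)"
    have m: "i < b m" unfolding m_def using ex by (rule LeastI_ex)
    then obtain k where k: "m = Suc k" using b(2) by (cases m) auto
    then have "\<not> i < b k" using not_less_Least[of k "\<lambda>k. i < b k"] m_def by simp
    with m k show ?thesis by (auto simp: range intro!: exI[of _ k])
  qed
  \<comment> \<open>Two different blocks are separated by the cut at the end of the earlier
    one.\<close>
  have off: "c i j = 0 \<and> c j i = 0"
    if "i \<in> block_range B k" "j \<in> block_range B l" "k < l" for i j k l
  proof -
    have "b (Suc k) \<le> b l" using that(3) mono by (simp add: strict_mono_less_eq)
    with that b(1)[of "Suc k"] show ?thesis by (auto simp: range splits_at_def)
  qed
  have "inf_direct_sum c B"
    unfolding inf_direct_sum_def
  proof (intro conjI allI ballI impI)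
    fix k show "square_mat (B k)" "0 < dim_row (B k)"
      using b(3)[of k] by (auto simp: B_def)
  next
    fix k i j assume "i \<in> block_range B k" "j \<in> block_range B k"
    then show "c i j = B k $$ (i - block_start B k, j - block_start B k)"
      unfolding range start by (auto simp: B_def)
  next
    fix i j assume *: "\<nexists>k. i \<in> block_range B k \<and> j \<in> block_range B k"
    obtain k l where "i \<in> block_range B k" "j \<in> block_range B l" using cover by blast
    with * off show "c i j = 0" by (metis nat_neq_iff)
  qed
  moreover have "dim_row (B k) \<le> d" for k using b(3)[of k] by (auto simp: B_def)
  ultimately show ?thesis by blast
qed

section \<open>Orthonormality for finite unitary matrices\<close>

definition extend_by_id :: "complex mat \<Rightarrow> nat \<Rightarrow> nat \<Rightarrow> complex" where
  "extend_by_id A i j =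
     (if i < dim_row A \<and> j < dim_col A then A $$ (i, j) else if i = j then 1 else 0)"

lemma orthonormal_rows_extend_by_id:
  assumes A: "A \<in> carrier_mat n n"
    and orth: "\<And>i j. i < n \<Longrightarrow> j < n \<Longrightarrow>
      (\<Sum>k<n. A $$ (i, k) * cnj (A $$ (j, k))) = (if i = j then 1 else 0)"
  shows "orthonormal_rows (extend_by_id A)"
  unfolding orthonormal_rows_def
proof (intro allI)
  fix i j
  let ?c = "extend_by_id A"
  let ?f = "\<lambda>k. ?c i k * cnj (?c j k)"
  show "?f sums (if i = j then 1 else 0)"
  proof (cases "i < n \<and> j < n")
    case True
    then have "?f sums sum ?f {..<n}"
      using A by (intro sums_finite) (auto simp: extend_by_id_def)
    moreover have "sum ?f {..<n} = (\<Sum>k<n. A $$ (i, k) * cnj (A $$ (j, k)))"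
      using True A by (intro sum.cong) (auto simp: extend_by_id_def)
    ultimately show ?thesis using orth True by simp
  next
    case False
    \<comment> \<open>If row \<open>i\<close> is a padding row, only column \<open>i\<close>
      contributes. If only row \<open>j\<close> is, all products vanish, and the support
      \<open>{i}\<close> still serves.\<close>
    then have "?f sums sum ?f {i}"
      using A by (intro sums_finite) (auto simp: extend_by_id_def)
    moreover have "sum ?f {i} = (if i = j then 1 else 0)"
      using False A by (auto simp: extend_by_id_def)
    ultimately show ?thesis by simp
  qed
qed

lemma unitary_mat_rows:
  assumes A: "A \<in> carrier_mat n n" and "unitary_mat A" and ij: "i < n" "j < n"
  shows "(\<Sum>k<n. A $$ (i, k) * cnj (A $$ (j, k))) = (if i = j then 1 else 0)"
proof -
  have "A * mat_adjoint A = 1\<^sub>m n"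
    using assms by (auto simp: unitary_mat_def inverts_mat_def)
  then have "(A * mat_adjoint A) $$ (i, j) = (if i = j then 1 else 0)" using ij by simp
  moreover have "(A * mat_adjoint A) $$ (i, j) = (\<Sum>k<n. A $$ (i, k) * cnj (A $$ (j, k)))"
    using A ij by (simp add: scalar_prod_def mat_adjoint_def mat_of_rows_def lessThan_atLeast0)
  ultimately show ?thesis by simp
qed

lemma unitary_mat_cols:
  assumes A: "A \<in> carrier_mat n n" and "unitary_mat A" and ij: "i < n" "j < n"
  shows "(\<Sum>k<n. A $$ (k, i) * cnj (A $$ (k, j))) = (if i = j then 1 else 0)"
proof -
  have "mat_adjoint A * A = 1\<^sub>m n"
    using assms by (auto simp: unitary_mat_def inverts_mat_def mat_adjoint_def)
  \<comment> \<open>The entry is taken at \<open>(j, i)\<close> because the adjoint, which carries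
    the conjugation, is the left factor and column \<open>j\<close> is to be conjugated.\<close>
  then have "(mat_adjoint A * A) $$ (j, i) = (if i = j then 1 else 0)" using ij by simp
  moreover have "(mat_adjoint A * A) $$ (j, i) = (\<Sum>k<n. A $$ (k, i) * cnj (A $$ (k, j)))"
    using A ij
    by (simp add: scalar_prod_def mat_adjoint_def mat_of_rows_def lessThan_atLeast0 mult.commute)
  ultimately show ?thesis by simp
qed

section \<open>Orthonormality for infinite unitary matrices\<close>

lemma finite_support_l2:
  assumes "finite K" "\<And>k. k \<notin> K \<Longrightarrow> x k = 0"
  shows "x \<in> l2"
  using assms summable_finite[of K "\<lambda>i. (cmod (x i))\<^sup>2"] by (auto simp: l2_def)

definition unit_seq :: "nat \<Rightarrow> nat \<Rightarrow> complex" where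
  "unit_seq j i = (if i = j then 1 else 0)"

lemma unit_seq_l2 [simp]: "unit_seq j \<in> l2"
  by (rule finite_support_l2[of "{j}"]) (auto simp: unit_seq_def)

lemma inf_mat_op_unit_seq: "inf_mat_op A (unit_seq j) = (\<lambda>i. A i j)"
proof
  fix i
  have "(\<Sum>k. A i k * unit_seq j k) = (\<Sum>k\<in>{j}. A i k * unit_seq j k)"
    by (rule suminf_finite) (auto simp: unit_seq_def)
  then show "inf_mat_op A (unit_seq j) i = A i j" by (simp add: inf_mat_op_def unit_seq_def)
qed

lemma l2_inner_unit_seq_left: "l2_inner (unit_seq j) y = cnj (y j)"
proof -
  have "(\<Sum>k. unit_seq j k * cnj (y k)) = (\<Sum>k\<in>{j}. unit_seq j k * cnj (y k))"
    by (rule suminf_finite) (auto simp: unit_seq_def)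
  then show ?thesis by (simp add: l2_inner_def unit_seq_def)
qed

lemma l2_inner_unit_seq_right: "l2_inner x (unit_seq j) = x j"
proof -
  have "(\<Sum>k. x k * cnj (unit_seq j k)) = (\<Sum>k\<in>{j}. x k * cnj (unit_seq j k))"
    by (rule suminf_finite) (auto simp: unit_seq_def)
  then show ?thesis by (simp add: l2_inner_def unit_seq_def)
qed

text \<open>Testing the adjoint \<open>S\<close> on canonical basis vectors shows that it acts by
  the conjugate transpose. Then T S = I yields the rows and S T = I the columns, T being the
  operator of \<open>A\<close>. The band condition makes all rows and columns finitely
  supported.\<close>

lemma unitary_inf_mat_orthonormal:
  assumes "unitary_inf_mat A" and diag: "pq_diagonal UNIV p q A"
  shows "orthonormal_rows A" and "orthonormal_rows (\<lambda>i j. A j i)"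
proof -
  obtain S where S: "\<And>y. y \<in> l2 \<Longrightarrow> S y \<in> l2"
    "\<And>x y. x \<in> l2 \<Longrightarrow> y \<in> l2 \<Longrightarrow> l2_inner (inf_mat_op A x) y = l2_inner x (S y)"
    "\<And>x. x \<in> l2 \<Longrightarrow> S (inf_mat_op A x) = x" "\<And>x. x \<in> l2 \<Longrightarrow> inf_mat_op A (S x) = x"
    using assms unfolding unitary_inf_mat_def by blast
  have col_l2: "(\<lambda>i. A i j) \<in> l2" for j
    by (rule finite_support_l2[of "{..j + p}"]) (auto intro: pq_diagonal_UNIV_D[OF diag])
  have S_unit: "S (unit_seq i) = (\<lambda>j. cnj (A i j))" for i
  proof
    fix j
    have "A i j = l2_inner (inf_mat_op A (unit_seq j)) (unit_seq i)"
      by (simp add: l2_inner_unit_seq_right inf_mat_op_unit_seq)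
    also have "\<dots> = cnj (S (unit_seq i) j)"
      by (simp add: S(2) l2_inner_unit_seq_left)
    finally show "S (unit_seq i) j = cnj (A i j)" by simp
  qed
  show "orthonormal_rows A"
    unfolding orthonormal_rows_def
  proof (intro allI)
    fix i j
    have "(\<Sum>k. A i k * cnj (A j k)) = inf_mat_op A (S (unit_seq j)) i"
      by (simp add: S_unit inf_mat_op_def)
    also have "\<dots> = (if i = j then 1 else 0)" by (simp add: S(4) unit_seq_def)
    finally have "(\<Sum>k. A i k * cnj (A j k)) = (if i = j then 1 else 0)" .
    \<comment> \<open>The value of an infinite sum does not by itself give convergence; here the
      band leaves finitely many terms.\<close>
    moreover have "summable (\<lambda>k. A i k * cnj (A j k))"
      by (rule summable_finite[of "{..i + q}"]) (auto intro: pq_diagonal_UNIV_D[OF diag])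
    ultimately show "(\<lambda>k. A i k * cnj (A j k)) sums (if i = j then 1 else 0)"
      by (simp add: sums_iff)
  qed
  show "orthonormal_rows (\<lambda>i j. A j i)"
    unfolding orthonormal_rows_def
  proof (intro allI)
    fix i j
    have "(\<Sum>k. A k i * cnj (A k j)) =
        l2_inner (inf_mat_op A (unit_seq i)) (inf_mat_op A (unit_seq j))"
      by (simp add: l2_inner_def inf_mat_op_unit_seq)
    \<comment> \<open>The second factor is moved across by the adjoint and cancelled by S T = I;
      \<open>col_l2\<close> puts it into \<open>l2\<close>, as the adjoint identity
      requires.\<close>
    also have "\<dots> = l2_inner (unit_seq i) (unit_seq j)"
      using S(2)[of "unit_seq i" "inf_mat_op A (unit_seq j)"] S(3)[of "unit_seq j"] col_l2
      by (simp add: inf_mat_op_unit_seq)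
    also have "\<dots> = (if i = j then 1 else 0)"
      by (simp add: l2_inner_unit_seq_right) (simp add: unit_seq_def)
    finally have "(\<Sum>k. A k i * cnj (A k j)) = (if i = j then 1 else 0)" .
    moreover have "summable (\<lambda>k. A k i * cnj (A k j))"
      by (rule summable_finite[of "{..i + p}"]) (auto intro: pq_diagonal_UNIV_D[OF diag])
    ultimately show "(\<lambda>k. A k i * cnj (A k j)) sums (if i = j then 1 else 0)"
      by (simp add: sums_iff)
  qed
qed

section \<open>Block decomposition in the finite and the infinite case\<close>

theorem theorem3p9:
  fixes p q :: nat
  assumes "p = 1 \<or> q = 1"
  shows
    "(\<forall>n. \<forall>A \<in> carrier_mat n n.
        unitary_mat A \<and> pq_diagonal {..<n} p q (\<lambda>i j. A $$ (i, j)) \<longrightarrow>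
        (\<exists>Bs. A = diag_block_mat Bs \<and>
              (\<forall>B \<in> set Bs. square_mat B \<and> 0 < dim_row B \<and> dim_row B \<le> p + q))) \<and>
     (\<forall>A. unitary_inf_mat A \<and> pq_diagonal UNIV p q A \<longrightarrow>
        (\<exists>B. inf_direct_sum A B \<and> (\<forall>k. dim_row (B k) \<le> p + q)))"
proof (intro conjI allI ballI impI)
  fix n and A :: "complex mat"
  assume A: "A \<in> carrier_mat n n"
    and "unitary_mat A \<and> pq_diagonal {..<n} p q (\<lambda>i j. A $$ (i, j))"
  then have unitary: "unitary_mat A" and diag: "pq_diagonal {..<n} p q (\<lambda>i j. A $$ (i, j))"
    by auto
  let ?c = "extend_by_id A"
  have rows: "orthonormal_rows ?c"
    by (rule orthonormal_rows_extend_by_id[OF A unitary_mat_rows[OF A unitary]])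
  \<comment> \<open>Padding commutes with transposition because \<open>A\<close> is square, so the
    columns are handled as rows of the transpose.\<close>
  have "(\<lambda>i j. ?c j i) = extend_by_id A\<^sup>T"
    using A by (auto simp: extend_by_id_def fun_eq_iff)
  moreover have "orthonormal_rows (extend_by_id A\<^sup>T)"
    using A unitary_mat_cols[OF A unitary]
    by (intro orthonormal_rows_extend_by_id[of _ n]) auto
  ultimately have cols: "orthonormal_rows (\<lambda>i j. ?c j i)" by simp
  \<comment> \<open>Padding adds nonzero entries on the diagonal only, which lies in every
    band.\<close>
  have diag': "pq_diagonal UNIV p q ?c"
    using diag A by (auto simp: pq_diagonal_def extend_by_id_def)
  have "splits_at ?c n" using A by (auto simp: splits_at_def extend_by_id_def)
  from diag_blocks_from_splits[OF _ this splits_at_0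
      pq_diagonal_next_split[OF assms rows cols diag']]
  have "\<exists>Bs. mat n n (\<lambda>(i, j). ?c i j) = diag_block_mat Bs \<and>
     (\<forall>B\<in>set Bs. square_mat B \<and> 0 < dim_row B \<and> dim_row B \<le> p + q)"
    by simp
  moreover have "mat n n (\<lambda>(i, j). ?c i j) = A"
    using A by (auto simp: extend_by_id_def)
  ultimately show "\<exists>Bs. A = diag_block_mat Bs \<and>
      (\<forall>B \<in> set Bs. square_mat B \<and> 0 < dim_row B \<and> dim_row B \<le> p + q)"
    by simp
next
  fix A
  assume A: "unitary_inf_mat A \<and> pq_diagonal UNIV p q A"
  with unitary_inf_mat_orthonormal[of A p q]
  have "orthonormal_rows A" "orthonormal_rows (\<lambda>i j. A j i)" by auto
  from pq_diagonal_next_split[OF assms this] A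
  show "\<exists>B. inf_direct_sum A B \<and> (\<forall>k. dim_row (B k) \<le> p + q)"
    by (intro inf_direct_sum_from_splits) auto
qed

end
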